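(* Let $\kappa\in\mathbb{R}$ and $\rho_0>0$, and consider the class of compact spaces $X$ with curvature $\leq\kappa$ and convexity radius $\rho(X)\ge\rho_0$. Then any family of spaces in this class that is precompact with respect to the Gromov–Hausdorff distance contains only finitely many homotopy types.
   Context: **Complete length spaces.** For a metric space $(X,d)$ the length of a continuous path $\gamma:[a,b]\to X$ is $L(\gamma)=\sup\sum_i d(\gamma(t_i),\gamma(t_{i+1}))$ over all partitions. $(X,d)$ is a length space if $d(x_1,x_2)$ is the infimum of lengths of paths joining $x_1,x_2$ for all $x_1,x_2$; it is a complete length space (geodesic space) if moreover any two points are joined by a shortest path, i.e. a path of length $d(x_1,x_2)$. **Convexity radius.** A subset $A$ of a length space is convex if any two points of $A$ are joined by a unique shortest path and this path lies in $A$. The convexity radius is $\rho(X)=\inf_{x\in X}\sup\{r\ge 0\mid \mathbb{B}_X(x,s)\text{ is convex for all }0<s<r\}$, where $\mathbb{B}_X(x,s)$ is the open metric ball. **Curvature $\leq\kappa$.** A complete length space $(X,d)$ has curvature $\leq\kappa$ if for any $x_1,x_2,x_3$ in a convex ball of $X$ (and, if $\kappa>0$, with $d(x_1,x_2)+d(x_2,x_3)+d(x_3,x_1)<2\pi/\sqrt{\kappa}$) and any $y$ on a shortest path joining $x_1$ and $x_3$, we have $d(y,x_2)\le d(\overline y,\overline x_2)$, where $\overline x_1,\overline x_2,\overline x_3$ are points of the model surface of constant curvature $\kappa$ with $d(\overline x_i,\overline x_j)=d(x_i,x_j)$ and $\overline y$ is the point on the shortest path joining $\overline x_1$ and $\overline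 x_3$ with $d(\overline x_1,\overline y)=d(x_1,y)$. **Precompactness.** A family of compact metric spaces is precompact if its set of isometry classes is relatively compact (equivalently, totally bounded) in the space of isometry classes of compact metric spaces with the Gromov–Hausdorff distance. *)

theory Defs
  imports "HOL-Analysis.Analysis"
begin

section \<open>Complete length spaces\<close>

text \<open>Paths are taken on the unit interval. A subdivision of it is a finite nondecreasing
  sequence \<open>t 0, \<dots>, t n\<close> with \<open>t 0 = 0\<close> and \<open>t n = 1\<close>.\<close>

definition path_length :: "'a metric \<Rightarrow> (real \<Rightarrow> 'a) \<Rightarrow> ereal" where
  "path_length X g =
     Sup {ereal (\<Sum>i<n. mdist X (g (t i)) (g (t (Suc i)))) | n t.
            mono_on {..n} t \<and> t 0 = 0 \<and> t n = (1::real)}"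

definition joins :: "'a metric \<Rightarrow> 'a \<Rightarrow> 'a \<Rightarrow> (real \<Rightarrow> 'a) \<Rightarrow> bool" where
  "joins X x y g \<longleftrightarrow> pathin (mtopology_of X) g \<and> g 0 = x \<and> g 1 = y"

definition shortest_path :: "'a metric \<Rightarrow> 'a \<Rightarrow> 'a \<Rightarrow> (real \<Rightarrow> 'a) \<Rightarrow> bool" where
  "shortest_path X x y g \<longleftrightarrow> joins X x y g \<and> path_length X g = ereal (mdist X x y)"

definition length_space :: "'a metric \<Rightarrow> bool" where
  "length_space X \<longleftrightarrow>
     (\<forall>x\<in>mspace X. \<forall>y\<in>mspace X. ereal (mdist X x y) = (INF g\<in>{g. joins X x y g}. path_length X g))"

definition complete_length_space :: "'a metric \<Rightarrow> bool" where
  "complete_length_space X \<longleftrightarrow>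
     length_space X \<and> (\<forall>x\<in>mspace X. \<forall>y\<in>mspace X. \<exists>g. shortest_path X x y g)"

section \<open>Convexity radius\<close>

text \<open>Uniqueness of a shortest path is meant up to reparametrization: two paths are identified
  if they become equal after composition with nondecreasing continuous surjections of the unit
  interval.\<close>

definition reparametrization :: "(real \<Rightarrow> real) \<Rightarrow> bool" where
  "reparametrization \<phi> \<longleftrightarrow>
     continuous_on {0..1} \<phi> \<and> mono_on {0..1} \<phi> \<and> \<phi> 0 = 0 \<and> \<phi> 1 = 1"

definition same_path :: "(real \<Rightarrow> 'a) \<Rightarrow> (real \<Rightarrow> 'a) \<Rightarrow> bool" where
  "same_path g h \<longleftrightarrow>
     (\<exists>\<phi> \<psi>. reparametrization \<phi> \<and> reparametrization \<psi> \<and> (\<forall>t\<in>{0..1}. g (\<phi> t) = h (\<psi> t)))"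

definition convex_in :: "'a metric \<Rightarrow> 'a set \<Rightarrow> bool" where
  "convex_in X A \<longleftrightarrow> A \<subseteq> mspace X \<and>
     (\<forall>x\<in>A. \<forall>y\<in>A. \<exists>g. shortest_path X x y g \<and> g ` {0..1} \<subseteq> A \<and>
        (\<forall>h. shortest_path X x y h \<longrightarrow> same_path g h))"

definition convexity_radius :: "'a metric \<Rightarrow> ereal" where
  "convexity_radius X =
     (INF x\<in>mspace X. SUP r\<in>{r. 0 \<le> r \<and> (\<forall>s. 0 < s \<and> s < r \<longrightarrow> convex_in X (mball_of X x s))}. ereal r)"

section \<open>Model surfaces of constant curvature\<close>

text \<open>All three models are realized inside \<open>real^3\<close>: the unit sphere with the angular metric
  divided by \<open>sqrt \<kappa>\<close>, a Euclidean plane, and the upper sheet of the unit hyperboloid with the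
  hyperbolic metric divided by \<open>sqrt (-\<kappa>)\<close>.\<close>

definition sphere_dist :: "real^3 \<Rightarrow> real^3 \<Rightarrow> real" where
  "sphere_dist u v = arccos (u \<bullet> v)"

definition lorentz :: "real^3 \<Rightarrow> real^3 \<Rightarrow> real" where
  "lorentz u v = u$1 * v$1 + u$2 * v$2 - u$3 * v$3"

definition hyperboloid :: "(real^3) set" where
  "hyperboloid = {u. lorentz u u = -1 \<and> u$3 > 0}"

definition hyp_dist :: "real^3 \<Rightarrow> real^3 \<Rightarrow> real" where
  "hyp_dist u v = arcosh (- lorentz u v)"

text \<open>The library demands a nonnegative distance function even off the carrier, hence the value 0
  there.\<close>

definition metric_on :: "'a set \<Rightarrow> ('a \<Rightarrow> 'a \<Rightarrow> real) \<Rightarrow> 'a metric" where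
  "metric_on S d = metric (S, \<lambda>x y. if x \<in> S \<and> y \<in> S then d x y else 0)"

definition model_surface :: "real \<Rightarrow> (real^3) metric" where
  "model_surface \<kappa> =
     (if \<kappa> > 0 then metric_on (sphere 0 1) (\<lambda>u v. sphere_dist u v / sqrt \<kappa>)
      else if \<kappa> = 0 then metric_on {u. u$3 = 0} dist
      else metric_on hyperboloid (\<lambda>u v. hyp_dist u v / sqrt (- \<kappa>)))"

text \<open>The constructor \<open>metric\<close> is only meaningful on pairs satisfying the metric axioms, which
  are verified here.\<close>

lemma sphere_dist_triangle:
  fixes u v w :: "real^3"
  assumes "norm u = 1" "norm v = 1" "norm w = 1"
  shows "sphere_dist u w \<le> sphere_dist u v + sphere_dist v w"
proof -
  have bd: "\<bar>a \<bullet> b\<bar> \<le> 1" if "norm a = 1" "norm b = 1" for a b :: "real^3"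
    using Cauchy_Schwarz_ineq2[of a b] that by simp
  define a where "a = u \<bullet> v"
  define b where "b = v \<bullet> w"
  have ab: "\<bar>a\<bar> \<le> 1" "\<bar>b\<bar> \<le> 1" "\<bar>u \<bullet> w\<bar> \<le> 1"
    using bd assms by (auto simp: a_def b_def)
  have nn: "u \<bullet> u = 1" "v \<bullet> v = 1" "w \<bullet> w = 1"
    using assms by (auto simp: dot_square_norm)
  have n1: "norm (u - a *\<^sub>R v) = sqrt (1 - a\<^sup>2)"
    unfolding norm_eq_sqrt_inner
    by (rule arg_cong[where f = sqrt])
       (simp add: inner_diff_left inner_diff_right nn inner_commute a_def power2_eq_square algebra_simps)
  have n2: "norm (w - b *\<^sub>R v) = sqrt (1 - b\<^sup>2)"
    unfolding norm_eq_sqrt_inner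
    by (rule arg_cong[where f = sqrt])
       (simp add: inner_diff_left inner_diff_right nn inner_commute b_def power2_eq_square algebra_simps)
  have ip: "(u - a *\<^sub>R v) \<bullet> (w - b *\<^sub>R v) = u \<bullet> w - a * b"
    by (simp add: inner_diff_left inner_diff_right nn inner_commute a_def b_def algebra_simps)
  have "\<bar>u \<bullet> w - a * b\<bar> \<le> sqrt (1 - a\<^sup>2) * sqrt (1 - b\<^sup>2)"
    using Cauchy_Schwarz_ineq2[of "u - a *\<^sub>R v" "w - b *\<^sub>R v"] unfolding ip n1 n2 .
  then have key: "a * b - sqrt (1 - a\<^sup>2) * sqrt (1 - b\<^sup>2) \<le> u \<bullet> w"
    by linarith
  have A: "0 \<le> arccos a" "arccos a \<le> pi" "0 \<le> arccos b" "arccos b \<le> pi"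
    using ab by (auto intro: arccos_lbound arccos_ubound)
  show ?thesis
  proof (cases "arccos a + arccos b \<le> pi")
    case True
    have "cos (arccos a + arccos b) = a * b - sqrt (1 - a\<^sup>2) * sqrt (1 - b\<^sup>2)"
      using ab by (simp add: cos_add sin_arccos abs_le_iff)
    then have "cos (arccos a + arccos b) \<le> cos (arccos (u \<bullet> w))"
      using key ab by (simp add: abs_le_iff)
    then have "arccos (u \<bullet> w) \<le> arccos a + arccos b"
      using True A ab by (subst (asm) cos_mono_le_eq) (auto intro: arccos_lbound arccos_ubound)
    then show ?thesis by (simp add: sphere_dist_def a_def b_def)
  next
    case False
    have "arccos (u \<bullet> w) \<le> pi" using ab by (intro arccos_ubound) auto
    then show ?thesis using False by (simp add: sphere_dist_def a_def b_def)
  qed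
qed

lemma sphere_dist_eq_0:
  fixes u v :: "real^3"
  assumes "norm u = 1" "norm v = 1"
  shows "sphere_dist u v = 0 \<longleftrightarrow> u = v"
proof
  assume "sphere_dist u v = 0"
  moreover have "\<bar>u \<bullet> v\<bar> \<le> 1" using Cauchy_Schwarz_ineq2[of u v] assms by simp
  ultimately have "u \<bullet> v = 1"
    by (metis abs_le_iff cos_arccos cos_zero minus_le_iff sphere_dist_def)
  then have "u \<bullet> v = norm u * norm v" using assms by simp
  then show "u = v" using assms norm_cauchy_schwarz_eq[of u v] by simp
next
  assume "u = v"
  then show "sphere_dist u v = 0" using assms by (simp add: sphere_dist_def dot_square_norm)
qed

lemma Metric_space_sphere:
  assumes "c > 0"
  shows "Metric_space (sphere 0 1) (\<lambda>u v. if u \<in> sphere 0 1 \<and> v \<in> sphere 0 1 then sphere_dist u v / c else 0)"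
proof -
  have "0 \<le> sphere_dist u v" if "norm u = 1" "norm v = 1" for u v
    using Cauchy_Schwarz_ineq2[of u v] that unfolding sphere_dist_def
    by (intro arccos_lbound) auto
  then show ?thesis
    using assms
    by unfold_locales
      (auto simp: sphere_dist_eq_0 divide_right_mono sphere_dist_triangle
            simp flip: add_divide_distrib, auto simp: sphere_dist_def inner_commute)
qed

lemma lorentz_commute: "lorentz u v = lorentz v u"
  by (simp add: lorentz_def algebra_simps)

lemma lorentz_le:
  assumes "u \<in> hyperboloid" "v \<in> hyperboloid"
  shows "lorentz u v \<le> -1" "lorentz u v = -1 \<Longrightarrow> u = v"
proof -
  have u: "(u$3)\<^sup>2 = 1 + (u$1)\<^sup>2 + (u$2)\<^sup>2" "u$3 > 0"
   and v: "(v$3)\<^sup>2 = 1 + (v$1)\<^sup>2 + (v$2)\<^sup>2" "v$3 > 0"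
    using assms by (auto simp: hyperboloid_def lorentz_def power2_eq_square)
  define s where "s = 1 + u$1 * v$1 + u$2 * v$2"
  have "(u$3 * v$3)\<^sup>2 = (1 + (u$1)\<^sup>2 + (u$2)\<^sup>2) * (1 + (v$1)\<^sup>2 + (v$2)\<^sup>2)"
    by (simp add: power_mult_distrib u v)
  then have eq: "(u$3 * v$3)\<^sup>2 = s\<^sup>2 + (u$1 - v$1)\<^sup>2 + (u$2 - v$2)\<^sup>2 + (u$1 * v$2 - u$2 * v$1)\<^sup>2"
    by (simp add: s_def power2_eq_square algebra_simps)
  then have "s\<^sup>2 \<le> (u$3 * v$3)\<^sup>2" by simp
  then have "s \<le> u$3 * v$3"
    using u(2) v(2) by (meson less_imp_le mult_nonneg_nonneg power2_le_imp_le)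
  then show "lorentz u v \<le> -1" by (simp add: s_def lorentz_def)
  assume "lorentz u v = -1"
  then have "u$3 * v$3 = s" by (simp add: s_def lorentz_def)
  with eq have "(u$1 - v$1)\<^sup>2 + (u$2 - v$2)\<^sup>2 + (u$1 * v$2 - u$2 * v$1)\<^sup>2 = 0" by simp
  then have 12: "u$1 = v$1" "u$2 = v$2"
    by (smt (verit) zero_le_power2 power2_eq_iff_nonneg zero_eq_power2)+
  with u v have "(u$3)\<^sup>2 = (v$3)\<^sup>2" by simp
  with u(2) v(2) have "u$3 = v$3" by (simp add: power2_eq_iff_nonneg)
  with 12 show "u = v" by (simp add: vec_eq_iff forall_3)
qed

lemma lorentz_Cauchy_Schwarz:
  assumes v: "v \<in> hyperboloid" and "lorentz x v = 0" "lorentz y v = 0"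
  shows "(lorentz x y)\<^sup>2 \<le> lorentz x x * lorentz y y"
proof -
  define n1 where "n1 = x$2 * y$3 - x$3 * y$2"
  define n2 where "n2 = x$3 * y$1 - x$1 * y$3"
  define n3 where "n3 = x$1 * y$2 - x$2 * y$1"
  have v3: "v$3 > 0" "(v$3)\<^sup>2 = 1 + (v$1)\<^sup>2 + (v$2)\<^sup>2"
    using v by (auto simp: hyperboloid_def lorentz_def power2_eq_square)
  have x3: "x$3 * v$3 = x$1 * v$1 + x$2 * v$2" and y3: "y$3 * v$3 = y$1 * v$1 + y$2 * v$2"
    using assms by (auto simp: lorentz_def)
  have id: "lorentz x x * lorentz y y - (lorentz x y)\<^sup>2 = n3\<^sup>2 - n1\<^sup>2 - n2\<^sup>2"
    by (simp add: lorentz_def n1_def n2_def n3_def power2_eq_square algebra_simps)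
  have "n1 * v$3 = x$2 * (y$3 * v$3) - (x$3 * v$3) * y$2"
    by (simp add: n1_def algebra_simps)
  also have "\<dots> = - n3 * v$1" unfolding x3 y3 by (simp add: n3_def algebra_simps)
  finally have 1: "n1 * v$3 = - n3 * v$1" .
  have "n2 * v$3 = (x$3 * v$3) * y$1 - x$1 * (y$3 * v$3)"
    by (simp add: n2_def algebra_simps)
  also have "\<dots> = - n3 * v$2" unfolding x3 y3 by (simp add: n3_def algebra_simps)
  finally have 2: "n2 * v$3 = - n3 * v$2" .
  have "(n3\<^sup>2 - n1\<^sup>2 - n2\<^sup>2) * (v$3)\<^sup>2 = n3\<^sup>2 * (v$3)\<^sup>2 - (n1 * v$3)\<^sup>2 - (n2 * v$3)\<^sup>2"
    by (simp add: algebra_simps power_mult_distrib)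
  also have "\<dots> = n3\<^sup>2" unfolding 1 2 v3(2) by (simp add: algebra_simps power_mult_distrib)
  finally have "(n3\<^sup>2 - n1\<^sup>2 - n2\<^sup>2) * (v$3)\<^sup>2 \<ge> 0" by simp
  then have "n3\<^sup>2 - n1\<^sup>2 - n2\<^sup>2 \<ge> 0" using v3(1) by (simp add: zero_le_mult_iff)
  with id show ?thesis by linarith
qed

lemma hyp_dist_triangle:
  assumes u: "u \<in> hyperboloid" and v: "v \<in> hyperboloid" and w: "w \<in> hyperboloid"
  shows "hyp_dist u w \<le> hyp_dist u v + hyp_dist v w"
proof -
  define a where "a = - lorentz u v"
  define b where "b = - lorentz v w"
  have a: "a \<ge> 1" and b: "b \<ge> 1" and c: "- lorentz u w \<ge> 1"
    using lorentz_le(1)[OF u v] lorentz_le(1)[OF v w] lorentz_le(1)[OF u w]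
    by (auto simp: a_def b_def)
  define x where "x = u - a *\<^sub>R v"
  define y where "y = w - b *\<^sub>R v"
  have nn: "lorentz u u = -1" "lorentz v v = -1" "lorentz w w = -1"
    using assms by (auto simp: hyperboloid_def)
  have exp: "lorentz (p - s *\<^sub>R v) (q - t *\<^sub>R v) =
      lorentz p q - t * lorentz p v - s * lorentz v q + s * t * lorentz v v" for p q s t
    by (simp add: lorentz_def algebra_simps)
  have exp1: "lorentz (p - s *\<^sub>R v) v = lorentz p v - s * lorentz v v" for p s
    by (simp add: lorentz_def algebra_simps)
  have "lorentz x v = 0" "lorentz y v = 0"
    using lorentz_commute[of w v] unfolding x_def y_def exp1 nn by (simp_all add: a_def b_def)
  from lorentz_Cauchy_Schwarz[OF v this]
  have "(lorentz x y)\<^sup>2 \<le> lorentz x x * lorentz y y" .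
  moreover have "lorentz x x = a\<^sup>2 - 1"
    using lorentz_commute[of u v] unfolding x_def exp nn
    by (simp add: a_def power2_eq_square algebra_simps)
  moreover have "lorentz y y = b\<^sup>2 - 1"
    using lorentz_commute[of w v] unfolding y_def exp nn
    by (simp add: b_def power2_eq_square algebra_simps)
  moreover have "lorentz x y = lorentz u w + a * b"
    unfolding x_def y_def exp nn by (simp add: a_def b_def algebra_simps)
  ultimately have "(lorentz u w + a * b)\<^sup>2 \<le> (a\<^sup>2 - 1) * (b\<^sup>2 - 1)" by simp
  then have "\<bar>lorentz u w + a * b\<bar> \<le> sqrt ((a\<^sup>2 - 1) * (b\<^sup>2 - 1))"
    using real_le_rsqrt by (metis power2_abs)
  then have "- lorentz u w \<le> a * b + sqrt (a\<^sup>2 - 1) * sqrt (b\<^sup>2 - 1)"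
    by (simp add: real_sqrt_mult abs_le_iff)
  also have "\<dots> = cosh (arcosh a + arcosh b)"
    using a b by (simp add: cosh_add sinh_arcosh_real)
  finally have "arcosh (- lorentz u w) \<le> arcosh (cosh (arcosh a + arcosh b))"
    using c by (smt (verit) arcosh_less_iff_real cosh_real_ge_1)
  also have "\<dots> = arcosh a + arcosh b"
    using a b by (intro arcosh_cosh_real add_nonneg_nonneg arcosh_nonneg_real)
  finally show ?thesis by (simp add: hyp_dist_def a_def b_def)
qed

lemma Metric_space_hyperboloid:
  assumes "c > 0"
  shows "Metric_space hyperboloid (\<lambda>u v. if u \<in> hyperboloid \<and> v \<in> hyperboloid then hyp_dist u v / c else 0)"
proof -
  have "0 \<le> hyp_dist u v" "hyp_dist u v = 0 \<longleftrightarrow> u = v" if "u \<in> hyperboloid" "v \<in> hyperboloid" for u v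
  proof -
    have ge: "1 \<le> - lorentz u v" using lorentz_le(1)[OF that] by simp
    then show "0 \<le> hyp_dist u v" unfolding hyp_dist_def by simp
    have "hyp_dist u v = 0 \<longleftrightarrow> lorentz u v = -1"
      using ge unfolding hyp_dist_def by (subst arcosh_eq_0_iff_real) auto
    also have "\<dots> \<longleftrightarrow> u = v"
      using lorentz_le(2)[OF that] that by (auto simp: hyperboloid_def)
    finally show "hyp_dist u v = 0 \<longleftrightarrow> u = v" .
  qed
  moreover have "hyp_dist u v = hyp_dist v u" for u v
    by (simp add: hyp_dist_def lorentz_commute)
  ultimately show ?thesis
    using assms
    by unfold_locales
      (auto simp: divide_right_mono hyp_dist_triangle simp flip: add_divide_distrib)
qed

lemma Metric_space_plane:
  "Metric_space S (\<lambda>u v. if u \<in> S \<and> v \<in> S then dist u v else 0)"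
  by unfold_locales (auto simp: dist_commute dist_triangle)

lemma mspace_metric_on:
  assumes "Metric_space S (\<lambda>x y. if x \<in> S \<and> y \<in> S then d x y else 0)"
  shows "mspace (metric_on S d) = S"
    and "\<lbrakk>x \<in> S; y \<in> S\<rbrakk> \<Longrightarrow> mdist (metric_on S d) x y = d x y"
  using assms by (simp_all add: metric_on_def Metric_space.mspace_metric Metric_space.mdist_metric)

lemma mspace_model_surface:
  "mspace (model_surface \<kappa>) =
     (if \<kappa> > 0 then sphere 0 1 else if \<kappa> = 0 then {u. u$3 = 0} else hyperboloid)"
  using mspace_metric_on(1)[OF Metric_space_sphere] mspace_metric_on(1)[OF Metric_space_plane]
    mspace_metric_on(1)[OF Metric_space_hyperboloid]
  by (auto simp: model_surface_def)

lemma mdist_model_surface: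
  assumes "u \<in> mspace (model_surface \<kappa>)" "v \<in> mspace (model_surface \<kappa>)"
  shows "mdist (model_surface \<kappa>) u v =
     (if \<kappa> > 0 then sphere_dist u v / sqrt \<kappa> else if \<kappa> = 0 then dist u v
      else hyp_dist u v / sqrt (- \<kappa>))"
  using assms mspace_metric_on(2)[OF Metric_space_sphere, of "sqrt \<kappa>" u v]
    mspace_metric_on(2)[OF Metric_space_plane, of u "{u. u$3 = 0}" v]
    mspace_metric_on(2)[OF Metric_space_hyperboloid, of "sqrt (- \<kappa>)" u v]
  unfolding mspace_model_surface by (auto simp: model_surface_def split: if_splits)

section \<open>Upper curvature bounds\<close>

definition in_convex_ball :: "'a metric \<Rightarrow> 'a set \<Rightarrow> bool" where
  "in_convex_ball X A \<longleftrightarrow>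
     (\<exists>c\<in>mspace X. \<exists>r>0. convex_in X (mball_of X c r) \<and> A \<subseteq> mball_of X c r)"

definition on_shortest_path :: "'a metric \<Rightarrow> 'a \<Rightarrow> 'a \<Rightarrow> 'a \<Rightarrow> bool" where
  "on_shortest_path X x z y \<longleftrightarrow> (\<exists>g. shortest_path X x z g \<and> y \<in> g ` {0..1})"

definition curvature_le :: "real \<Rightarrow> 'a metric \<Rightarrow> bool" where
  "curvature_le \<kappa> X \<longleftrightarrow> complete_length_space X \<and>
     (\<forall>x1 x2 x3 y.
        in_convex_ball X {x1, x2, x3} \<longrightarrow>
        (\<kappa> > 0 \<longrightarrow> mdist X x1 x2 + mdist X x2 x3 + mdist X x3 x1 < 2 * pi / sqrt \<kappa>) \<longrightarrow>
        on_shortest_path X x1 x3 y \<longrightarrow>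
        (\<forall>x1' \<in> mspace (model_surface \<kappa>). \<forall>x2' \<in> mspace (model_surface \<kappa>).
         \<forall>x3' \<in> mspace (model_surface \<kappa>). \<forall>y' \<in> mspace (model_surface \<kappa>).
           mdist (model_surface \<kappa>) x1' x2' = mdist X x1 x2 \<longrightarrow>
           mdist (model_surface \<kappa>) x2' x3' = mdist X x2 x3 \<longrightarrow>
           mdist (model_surface \<kappa>) x3' x1' = mdist X x3 x1 \<longrightarrow>
           on_shortest_path (model_surface \<kappa>) x1' x3' y' \<longrightarrow>
           mdist (model_surface \<kappa>) x1' y' = mdist X x1 y \<longrightarrow>
           mdist X y x2 \<le> mdist (model_surface \<kappa>) y' x2'))"

section \<open>Gromov--Hausdorff distance\<close>

text \<open>The infimum is taken in the extended reals, so the Hausdorff distance between the empty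
  set and a nonempty set is infinite.\<close>

definition hausdorff_dist :: "'a metric \<Rightarrow> 'a set \<Rightarrow> 'a set \<Rightarrow> ereal" where
  "hausdorff_dist Z A B =
     Inf {ereal r | r. r > 0 \<and> A \<subseteq> (\<Union>b\<in>B. mball_of Z b r) \<and> B \<subseteq> (\<Union>a\<in>A. mball_of Z a r)}"

definition isometric_embedding :: "'a metric \<Rightarrow> 'b metric \<Rightarrow> ('a \<Rightarrow> 'b) \<Rightarrow> bool" where
  "isometric_embedding X Z f \<longleftrightarrow> f ` mspace X \<subseteq> mspace Z \<and>
     (\<forall>x\<in>mspace X. \<forall>y\<in>mspace X. mdist Z (f x) (f y) = mdist X x y)"

text \<open>The infimum ranges over all metric spaces \<open>Z\<close> containing isometric copies of \<open>X\<close> and \<open>Y\<close>.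
  Only the union of the two copies matters, and it injects into the sum type, so nothing is lost
  by taking the points of \<open>Z\<close> there.\<close>

definition GH_dist :: "'a metric \<Rightarrow> 'b metric \<Rightarrow> ereal" where
  "GH_dist X Y =
     Inf {hausdorff_dist Z (f ` mspace X) (g ` mspace Y) | (Z :: ('a + 'b) metric) f g.
            isometric_embedding X Z f \<and> isometric_embedding Y Z g}"

text \<open>Total boundedness for the Gromov--Hausdorff distance, phrased with representatives of the
  isometry classes.\<close>

definition GH_precompact :: "'a metric set \<Rightarrow> bool" where
  "GH_precompact F \<longleftrightarrow> (\<forall>X\<in>F. compact_space (mtopology_of X)) \<and>
     (\<forall>\<epsilon>::real. \<epsilon> > 0 \<longrightarrow> (\<exists>K. finite K \<and> K \<subseteq> F \<and> (\<forall>X\<in>F. \<exists>Y\<in>K. GH_dist Y X < ereal \<epsilon>)))"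

section \<open>Homotopy types\<close>

definition same_homotopy_type :: "('a metric \<times> 'a metric) set" where
  "same_homotopy_type =
     {(X, Y). mtopology_of X homotopy_equivalent_space mtopology_of Y}"

definition homotopy_types :: "'a metric set \<Rightarrow> 'a metric set set" where
  "homotopy_types F = F // same_homotopy_type"

end

theory Submission
  imports Defs
begin

text \<open>Two spaces of the class at Gromov--Hausdorff distance less than \<open>\<rho>\<^sub>0 / 12\<close> are homotopy
  equivalent, so a finite \<open>\<rho>\<^sub>0 / 12\<close>-net of the family meets all homotopy types. A correspondence
  between \<open>X\<close> and \<open>Y\<close> of small distortion sends a finite net of \<open>X\<close> to points of \<open>Y\<close>. Interpolating
  these points along geodesics, with weights from bump functions around the net, gives a
  continuous map \<open>X \<rightarrow> Y\<close> which stays near the correspondence because small balls of \<open>Y\<close> are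
  convex. Such maps in the two directions compose to maps moving points by less than \<open>\<rho>\<^sub>0\<close>, and
  these are homotopic to the identity along the unique shortest paths.\<close>

section \<open>Shortest paths: additivity of distances and concatenation\<close>

text \<open>The subdivision \<open>0, s, t, 1\<close> gives a sum of distances that is at most the
  length \<open>mdist X x y\<close>. The triangle inequality bounds it from the other side, so no
  piece has any slack.\<close>

lemma shortest_path_mdist:
  assumes g: "shortest_path X x y g" and st: "0 \<le> s" "s \<le> t" "t \<le> 1"
  shows "mdist X (g s) (g t) = mdist X x (g t) - mdist X x (g s)"
proof -
  have p: "pathin (mtopology_of X) g" and g01: "g 0 = x" "g 1 = y"
    and len: "path_length X g = ereal (mdist X x y)"
    using g by (auto simp: shortest_path_def joins_def)
  have gM: "g u \<in> mspace X" if "0 \<le> u" "u \<le> 1" for u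
    using p that by (auto simp: pathin_def continuous_map_def)
  define \<tau> :: "nat \<Rightarrow> real" where
    "\<tau> = (\<lambda>i. if i = 0 then 0 else if i = 1 then s else if i = 2 then t else 1)"
  have "mono_on {..3} \<tau>" "\<tau> 0 = 0" "\<tau> 3 = 1"
    using st by (auto simp: \<tau>_def mono_on_def)
  then have "ereal (\<Sum>i<3. mdist X (g (\<tau> i)) (g (\<tau> (Suc i)))) \<le> path_length X g"
    unfolding path_length_def by (intro Sup_upper) blast
  then have "mdist X x (g s) + mdist X (g s) (g t) + mdist X (g t) y \<le> mdist X x y"
    by (simp add: len \<tau>_def numeral_3_eq_3 g01)
  moreover have "mdist X x y \<le> mdist X x (g t) + mdist X (g t) y"
    and "mdist X x (g t) \<le> mdist X x (g s) + mdist X (g s) (g t)"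
    using gM[of 0] gM[of 1] gM[of s] gM[of t] st by (auto simp: g01 intro!: mdist_triangle)
  ultimately show ?thesis by linarith
qed

text \<open>Converse of \<open>shortest_path_mdist\<close>: if distances from \<open>x\<close> add
  up along \<open>g\<close>, every subdivision sum telescopes to \<open>mdist X x y\<close>, so the
  supremum defining the length is over a singleton.\<close>

lemma shortest_pathI:
  assumes g: "joins X x y g"
    and add: "\<And>s t. \<lbrakk>0 \<le> s; s \<le> t; t \<le> 1\<rbrakk> \<Longrightarrow>
                mdist X (g s) (g t) = mdist X x (g t) - mdist X x (g s)"
  shows "shortest_path X x y g"
proof -
  have g01: "g 0 = x" "g 1 = y" and "x \<in> mspace X"
    using g path_start_in_topspace[of "mtopology_of X" g] by (auto simp: joins_def)
  have sum: "(\<Sum>i<n. mdist X (g (t i)) (g (t (Suc i)))) = mdist X x y"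
    if t: "mono_on {..n} t" "t 0 = 0" "t n = 1" for n and t :: "nat \<Rightarrow> real"
  proof -
    have "(\<Sum>i<n. mdist X (g (t i)) (g (t (Suc i)))) =
        (\<Sum>i<n. mdist X x (g (t (Suc i))) - mdist X x (g (t i)))"
    proof (rule sum.cong)
      fix i assume "i \<in> {..<n}"
      then have "t 0 \<le> t i" "t i \<le> t (Suc i)" "t (Suc i) \<le> t n"
        using t(1) by (auto intro!: mono_onD[OF t(1)])
      then show "mdist X (g (t i)) (g (t (Suc i))) = mdist X x (g (t (Suc i))) - mdist X x (g (t i))"
        using t by (intro add) auto
    qed simp
    also have "\<dots> = mdist X x (g (t n)) - mdist X x (g (t 0))"
      by (rule sum_lessThan_telescope)
    finally show ?thesis using t \<open>x \<in> mspace X\<close> by (simp add: g01)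
  qed
  have "{ereal (\<Sum>i<n. mdist X (g (t i)) (g (t (Suc i)))) | n t.
          mono_on {..n} t \<and> t 0 = 0 \<and> t n = (1::real)} = {ereal (mdist X x y)}" (is "?S = _")
  proof (intro equalityI subsetI)
    fix a assume "a \<in> ?S" then show "a \<in> {ereal (mdist X x y)}" using sum by auto
  next
    fix a assume "a \<in> {ereal (mdist X x y)}"
    \<comment> \<open>The trivial subdivision \<open>0, 1\<close>, written as \<open>real\<close> on
      \<open>{..1}\<close>, shows that the set of sums is not empty.\<close>
    moreover have "mono_on {..1} real" by (auto simp: mono_on_def)
    ultimately show "a \<in> ?S"
      using sum[of 1 real] by (intro CollectI exI[of _ 1] exI[of _ real]) auto
  qed
  then show ?thesis using g by (simp add: shortest_path_def path_length_def)
qed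

lemma pathin_concat:
  assumes g: "pathin T g" and h: "pathin T h" and gh: "g 1 = h 0"
  shows "pathin T (\<lambda>t. if t \<le> 1/2 then g (2 * t) else h (2 * t - 1))"
proof -
  let ?I = "top_of_set {0..1::real}"
  have 1: "continuous_map (subtopology ?I {t \<in> topspace ?I. t \<le> 1/2}) T (g \<circ> (\<lambda>t. 2 * t))"
    using g unfolding pathin_def
    by (intro continuous_map_compose)
       (auto simp: continuous_map_in_subtopology subtopology_subtopology intro!: continuous_intros)
  have 2: "continuous_map (subtopology ?I {t \<in> topspace ?I. 1/2 \<le> t}) T (h \<circ> (\<lambda>t. 2 * t - 1))"
    using h unfolding pathin_def
    by (intro continuous_map_compose)
       (auto simp: continuous_map_in_subtopology subtopology_subtopology intro!: continuous_intros)
  have "continuous_map ?I T (\<lambda>t. if t \<le> 1/2 then (g \<circ> (\<lambda>t. 2 * t)) t else (h \<circ> (\<lambda>t. 2 * t - 1)) t)"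
  proof (rule continuous_map_cases_le[OF _ _ 1 2])
    fix t :: real assume "t = 1/2"
    show "(g \<circ> (\<lambda>t. 2 * t)) t = (h \<circ> (\<lambda>t. 2 * t - 1)) t"
      unfolding \<open>t = 1/2\<close> by (simp add: gh)
  qed auto
  then show ?thesis unfolding pathin_def o_def .
qed

text \<open>Checked through \<open>shortest_pathI\<close>: since \<open>m\<close> lies metrically
  between \<open>x\<close> and \<open>y\<close>, distances from \<open>x\<close> keep adding up
  after the path has passed \<open>m\<close>.\<close>

lemma shortest_path_concat:
  assumes g: "shortest_path X x m g" and h: "shortest_path X m y h"
    and m: "mdist X x m + mdist X m y = mdist X x y"
  shows "shortest_path X x y (\<lambda>t. if t \<le> 1/2 then g (2 * t) else h (2 * t - 1))" (is "shortest_path X x y ?p")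
proof (rule shortest_pathI)
  have pg: "pathin (mtopology_of X) g" "g 0 = x" "g 1 = m"
    and ph: "pathin (mtopology_of X) h" "h 0 = m" "h 1 = y"
    using g h by (auto simp: shortest_path_def joins_def)
  then show "joins X x y ?p" using pathin_concat[OF pg(1) ph(1)] by (simp add: joins_def)
  have gM: "g u \<in> mspace X" "h u \<in> mspace X" if "0 \<le> u" "u \<le> 1" for u
    using pg ph that by (auto simp: pathin_def continuous_map_def)
  have M: "x \<in> mspace X" "m \<in> mspace X" "y \<in> mspace X"
    using gM[of 0] gM[of 1] pg ph by auto
  have hx: "mdist X x (h u) = mdist X x m + mdist X m (h u)" if u: "0 \<le> u" "u \<le> 1" for u
  proof -
    have "mdist X (h u) y = mdist X m y - mdist X m (h u)"
      using shortest_path_mdist[OF h, of u 1] u ph by simp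
    moreover have "mdist X x y \<le> mdist X x (h u) + mdist X (h u) y"
      "mdist X x (h u) \<le> mdist X x m + mdist X m (h u)"
      using M gM[OF u] by (auto intro!: mdist_triangle)
    ultimately show ?thesis using m by linarith
  qed
  fix s t :: real assume st: "0 \<le> s" "s \<le> t" "t \<le> 1"
  consider "t \<le> 1/2" | "s \<le> 1/2" "1/2 < t" | "1/2 < s" by linarith
  then show "mdist X (?p s) (?p t) = mdist X x (?p t) - mdist X x (?p s)"
  proof cases
    case 1
    then show ?thesis using st shortest_path_mdist[OF g, of "2 * s" "2 * t"] by simp
  next
    case 2
    have gs: "mdist X (g (2 * s)) m = mdist X x m - mdist X x (g (2 * s))"
      using shortest_path_mdist[OF g, of "2 * s" 1] 2 st pg by simp
    have "g (2 * s) \<in> mspace X" "h (2 * t-1) \<in> mspace X" using gM 2 st by auto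
    \<comment> \<open>For parameters on both sides of \<open>1/2\<close>, the detour through
      \<open>m\<close> bounds the distance from above and the triangle with \<open>x\<close> bounds
      it from below.\<close>
    then have "mdist X (g (2 * s)) (h (2 * t-1)) \<le> mdist X (g (2 * s)) m + mdist X m (h (2 * t-1))"
      "mdist X x (h (2 * t-1)) \<le> mdist X x (g (2 * s)) + mdist X (g (2 * s)) (h (2 * t-1))"
      using M by (auto intro!: mdist_triangle)
    then show ?thesis using 2 st gs hx[of "2 * t-1"] by simp
  next
    case 3
    then show ?thesis
      using st hx[of "2 * t-1"] hx[of "2 * s-1"] shortest_path_mdist[OF h, of "2 * s-1" "2 * t-1"] by simp
  qed
qed

section \<open>Points dividing a pair in a given ratio, and convex balls\<close>

text \<open>Replaces shortest paths by their individual points, so that the later arguments deal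
  with distances only and parametrizations disappear.\<close>

definition point_between :: "'a metric \<Rightarrow> real \<Rightarrow> 'a \<Rightarrow> 'a \<Rightarrow> 'a \<Rightarrow> bool" where
  "point_between X t x y m \<longleftrightarrow> m \<in> mspace X \<and>
     mdist X x m = t * mdist X x y \<and> mdist X m y = (1 - t) * mdist X x y"

lemma point_between_mdist_add:
  "point_between X t x y m \<Longrightarrow> mdist X x m + mdist X m y = mdist X x y"
  by (simp add: point_between_def algebra_simps)

text \<open>A shortest path need not be parametrized proportionally to arc length, so the parameter
  of the wanted point comes from the intermediate value theorem for the distance from
  \<open>x\<close>.\<close>

lemma shortest_path_point_between:
  assumes g: "shortest_path X x y g" and t: "0 \<le> t" "t \<le> 1"
  shows "\<exists>m. point_between X t x y m"
proof -
  have p: "pathin (mtopology_of X) g" and g01: "g 0 = x" "g 1 = y"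
    using g by (auto simp: shortest_path_def joins_def)
  have gM: "g u \<in> mspace X" if "0 \<le> u" "u \<le> 1" for u
    using p that by (auto simp: pathin_def continuous_map_def)
  have x: "x \<in> mspace X" using gM[of 0] g01 by simp
  have "mdist X x x = 0" using x by simp
  have "continuous_map (top_of_set {0..1}) euclidean (\<lambda>u. mdist X x (g u))"
    using p x by (intro continuous_map_mdist) (auto simp: pathin_def)
  then have "continuous_on {0..1} (\<lambda>u. mdist X x (g u))" by simp
  moreover have "mdist X x (g 0) \<le> t * mdist X x y" "t * mdist X x y \<le> mdist X x (g 1)"
    using t \<open>mdist X x x = 0\<close> by (auto simp: g01 mult_left_le_one_le)
  ultimately obtain u where u: "0 \<le> u" "u \<le> 1" "mdist X x (g u) = t * mdist X x y"
    using IVT'[of "\<lambda>u. mdist X x (g u)" 0 "t * mdist X x y" 1] by auto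
  have "mdist X (g u) y = (1 - t) * mdist X x y"
    using shortest_path_mdist[OF g, of u 1] u by (simp add: g01 algebra_simps)
  then show ?thesis using u gM by (auto simp: point_between_def)
qed

text \<open>Reparametrizations map onto the unit interval by the intermediate value theorem.
  Uniqueness up to reparametrization thereby becomes a statement about the points that a path
  visits.\<close>

lemma same_path_image:
  assumes "same_path g h" "u \<in> {0..1}"
  shows "h u \<in> g ` {0..1}"
proof -
  obtain \<phi> \<psi> where \<phi>: "reparametrization \<phi>" and \<psi>: "reparametrization \<psi>"
    and eq: "\<And>t. t \<in> {0..1} \<Longrightarrow> g (\<phi> t) = h (\<psi> t)"
    using assms(1) by (auto simp: same_path_def)
  obtain t where t: "0 \<le> t" "t \<le> 1" "\<psi> t = u"
    using IVT'[of \<psi> 0 u 1] \<psi> assms(2) by (auto simp: reparametrization_def)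
  have "\<phi> 0 \<le> \<phi> t" "\<phi> t \<le> \<phi> 1"
    using \<phi> t monotone_onD[of "{0..1}" "(\<le>)" "(\<le>)" \<phi>]
    unfolding reparametrization_def by force+
  then have "\<phi> t \<in> {0..1}" using \<phi> by (auto simp: reparametrization_def)
  then show ?thesis using eq[of t] t by (metis atLeastAtMost_iff imageI)
qed

text \<open>A point realizing equality in the triangle inequality lies on a shortest path, obtained by
  concatenation, hence on the unique one provided by convexity.\<close>

lemma convex_in_shortest_path:
  assumes X: "complete_length_space X" and A: "convex_in X A" and xy: "x \<in> A" "y \<in> A"
  shows "\<exists>g. shortest_path X x y g \<and> g ` {0..1} \<subseteq> A \<and>
    (\<forall>m\<in>mspace X. mdist X x m + mdist X m y = mdist X x y \<longrightarrow> m \<in> g ` {0..1})"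
proof -
  obtain g where g: "shortest_path X x y g" "g ` {0..1} \<subseteq> A"
    and u: "\<And>h. shortest_path X x y h \<Longrightarrow> same_path g h"
    using A xy unfolding convex_in_def by blast
  have "m \<in> g ` {0..1}" if m: "m \<in> mspace X" "mdist X x m + mdist X m y = mdist X x y" for m
  proof -
    have "x \<in> mspace X" "y \<in> mspace X" using A xy by (auto simp: convex_in_def)
    then obtain h k where h: "shortest_path X x m h" and k: "shortest_path X m y k"
      using X m unfolding complete_length_space_def by blast
    \<comment> \<open>At \<open>1/2\<close> the concatenation is still in its first branch, with
      value \<open>h 1\<close>.\<close>
    have "h 1 = m" using h by (simp add: shortest_path_def joins_def)
    then show ?thesis
      using same_path_image[OF u[OF shortest_path_concat[OF h k m(2)]], of "1/2"] by simp
  qed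
  with g show ?thesis by blast
qed

text \<open>The supremum of admissible radii at \<open>x\<close> need not be attained; strictness of
  \<open>s < \<rho>\<close> still leaves an admissible radius above \<open>s\<close>.\<close>

lemma convexity_radius_ball_convex:
  assumes "ereal \<rho> \<le> convexity_radius X" "x \<in> mspace X" "0 < s" "s < \<rho>"
  shows "convex_in X (mball_of X x s)"
proof -
  have "ereal s < convexity_radius X" using assms by (meson ereal_less_eq(3) less_le_trans less_ereal.simps(1))
  also have "\<dots> \<le> (SUP r\<in>{r. 0 \<le> r \<and> (\<forall>s. 0 < s \<and> s < r \<longrightarrow> convex_in X (mball_of X x s))}. ereal r)"
    unfolding convexity_radius_def using assms(2) by (rule INF_lower)
  finally show ?thesis using assms(3) by (auto simp: less_SUP_iff)
qed

text \<open>The interface for the homotopy argument: dividing points exist for all pairs, are unique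
  for pairs closer than \<rho>, and stay in balls of radius below \<rho> that contain both
  ends.\<close>

locale locally_convex_geodesic =
  fixes X :: "'a metric" and \<rho> :: real
  assumes compact: "compact_space (mtopology_of X)"
    and between_exists: "\<lbrakk>x \<in> mspace X; y \<in> mspace X; 0 \<le> t; t \<le> 1\<rbrakk> \<Longrightarrow> \<exists>m. point_between X t x y m"
    and between_unique: "\<lbrakk>x \<in> mspace X; y \<in> mspace X; mdist X x y < \<rho>;
      point_between X t x y m; point_between X t x y m'\<rbrakk> \<Longrightarrow> m = m'"
    and ball_convex: "\<lbrakk>x \<in> mspace X; y \<in> mspace X; z \<in> mspace X; point_between X t x y m;
      mdist X z x < s; mdist X z y < s; s < \<rho>\<rbrakk> \<Longrightarrow> mdist X z m < s"

lemma locally_convex_geodesicI: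
  assumes X: "complete_length_space X" and c: "compact_space (mtopology_of X)"
    and r: "ereal \<rho> \<le> convexity_radius X"
  shows "locally_convex_geodesic X \<rho>"
proof
  show "compact_space (mtopology_of X)" by (fact c)
next
  fix x y t assume "x \<in> mspace X" "y \<in> mspace X" "0 \<le> t" "t \<le> (1::real)"
  then show "\<exists>m. point_between X t x y m"
    using X shortest_path_point_between[of X x y] unfolding complete_length_space_def by metis
next
  fix x y t m m'
  assume M: "x \<in> mspace X" "y \<in> mspace X" and d: "mdist X x y < \<rho>"
    and m: "point_between X t x y m" and m': "point_between X t x y m'"
  \<comment> \<open>The ball around \<open>x\<close> must be large enough to contain
    \<open>y\<close> and small enough to be convex.\<close>
  obtain s where s: "mdist X x y < s" "s < \<rho>" using dense[OF d] by blast
  then have "0 < s" using mdist_nonneg[of X x y] by linarith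
  then have A: "convex_in X (mball_of X x s)" using M s r by (intro convexity_radius_ball_convex)
  have "mdist X x x = 0" using M by simp
  then have xy: "x \<in> mball_of X x s" "y \<in> mball_of X x s" using M s \<open>0 < s\<close> by (auto simp del: mdist_zero)
  obtain g where g: "shortest_path X x y g" and
    on: "\<forall>m\<in>mspace X. mdist X x m + mdist X m y = mdist X x y \<longrightarrow> m \<in> g ` {0..1}"
    using convex_in_shortest_path[OF X A xy] by blast
  have "m \<in> g ` {0..1}" "m' \<in> g ` {0..1}"
    using on point_between_mdist_add[OF m] point_between_mdist_add[OF m'] m m'
    by (simp_all add: point_between_def)
  then obtain u v where "u \<in> {0..1}" "v \<in> {0..1}" and mm': "m = g u" "m' = g v" by blast
  then have uv: "0 \<le> u" "u \<le> 1" "0 \<le> v" "v \<le> 1" by simp_all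
  have "mdist X x m = mdist X x m'" using m m' by (simp add: point_between_def)
  \<comment> \<open>Both points lie on one shortest path at the same distance from \<open>x\<close>.
    The additivity is given for both orders of \<open>u\<close> and \<open>v\<close>, as either may
    be the smaller.\<close>
  then have "mdist X m m' = 0"
    using shortest_path_mdist[OF g, of u v] shortest_path_mdist[OF g, of v u] uv
      mdist_commute[of X "g u" "g v"] unfolding mm' by linarith
  then show "m = m'" using m m' by (auto simp: point_between_def)
next
  fix x y z t m s
  assume M: "x \<in> mspace X" "y \<in> mspace X" "z \<in> mspace X" and m: "point_between X t x y m"
    and s: "mdist X z x < s" "mdist X z y < s" "s < \<rho>"
  then have "0 < s" using mdist_nonneg[of X z x] by linarith
  then have A: "convex_in X (mball_of X z s)" using M s r by (intro convexity_radius_ball_convex)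
  have xy: "x \<in> mball_of X z s" "y \<in> mball_of X z s" using M s by auto
  obtain g where "shortest_path X x y g" and g: "g ` {0..1} \<subseteq> mball_of X z s" and
    on: "\<forall>m\<in>mspace X. mdist X x m + mdist X m y = mdist X x y \<longrightarrow> m \<in> g ` {0..1}"
    using convex_in_shortest_path[OF X A xy] by blast
  have "m \<in> g ` {0..1}" using on point_between_mdist_add[OF m] m by (simp add: point_between_def)
  with g show "mdist X z m < s" by auto
qed

section \<open>Limits along filters in terms of the distance\<close>

lemma limitin_mtopology_of:
  "limitin (mtopology_of X) f l F \<longleftrightarrow>
     l \<in> mspace X \<and> (\<forall>\<^sub>F x in F. f x \<in> mspace X) \<and> ((\<lambda>x. mdist X (f x) l) \<longlongrightarrow> 0) F"
  unfolding mtopology_of_def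
  by (rule Metric_space.limitin_metric_dist_null[OF Metric_space_mspace_mdist])

lemma limitin_mtopology_of_metric:
  "limitin (mtopology_of X) f l F \<longleftrightarrow>
     l \<in> mspace X \<and> (\<forall>\<epsilon>>0. \<forall>\<^sub>F x in F. f x \<in> mspace X \<and> mdist X (f x) l < \<epsilon>)"
  unfolding mtopology_of_def
  by (rule Metric_space.limitin_metric[OF Metric_space_mspace_mdist])

lemma tendsto_mdist:
  assumes "limitin (mtopology_of X) f a F" "limitin (mtopology_of X) g b F"
  shows "((\<lambda>x. mdist X (f x) (g x)) \<longlongrightarrow> mdist X a b) F"
proof -
  have "limitin (prod_topology (mtopology_of X) (mtopology_of X)) (\<lambda>x. (f x, g x)) (a, b) F"
    using assms by (simp add: limitin_pairwise o_def)
  from continuous_map_limit[OF continuous_map_metric this]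
  show ?thesis by (simp add: o_def)
qed

section \<open>Geodesic interpolation and homotopies between nearby maps\<close>

context locally_convex_geodesic
begin

text \<open>For pairs at distance \<rho> or more the choice is arbitrary and may jump, but the
  distances to the two ends are right for every pair.\<close>

definition geo :: "'a \<Rightarrow> 'a \<Rightarrow> real \<Rightarrow> 'a" where
  "geo x y t = (SOME m. point_between X t x y m)"

lemma geo_between:
  assumes "x \<in> mspace X" "y \<in> mspace X" "0 \<le> t" "t \<le> 1"
  shows "point_between X t x y (geo x y t)"
  unfolding geo_def using between_exists[OF assms] by (rule someI_ex)

lemma
  assumes "x \<in> mspace X" "y \<in> mspace X" "0 \<le> t" "t \<le> 1"
  shows geo_in: "geo x y t \<in> mspace X"
    and mdist_geo_left: "mdist X x (geo x y t) = t * mdist X x y"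
    and mdist_geo_right: "mdist X (geo x y t) y = (1 - t) * mdist X x y"
  using geo_between[OF assms] by (auto simp: point_between_def)

lemma geo_0: "\<lbrakk>x \<in> mspace X; y \<in> mspace X\<rbrakk> \<Longrightarrow> geo x y 0 = x"
  using mdist_geo_left[of x y 0] geo_in[of x y 0] by simp

lemma geo_1: "\<lbrakk>x \<in> mspace X; y \<in> mspace X\<rbrakk> \<Longrightarrow> geo x y 1 = y"
  using mdist_geo_right[of x y 1] geo_in[of x y 1] by simp

text \<open>By compactness, points dividing nearby pairs in nearby ratios accumulate only at points
  dividing the limit pair, and there is only one such point.\<close>

lemma geo_continuous_at:
  assumes M: "x0 \<in> mspace X" "y0 \<in> mspace X" and d: "mdist X x0 y0 < \<rho>"
    and t0: "0 \<le> t0" "t0 \<le> 1" and \<epsilon>: "0 < \<epsilon>"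
  shows "\<exists>\<delta>>0. \<forall>x\<in>mspace X. \<forall>y\<in>mspace X. \<forall>t\<in>{0..1}.
    mdist X x x0 < \<delta> \<longrightarrow> mdist X y y0 < \<delta> \<longrightarrow> \<bar>t - t0\<bar> < \<delta> \<longrightarrow> mdist X (geo x y t) (geo x0 y0 t0) < \<epsilon>"
proof (rule ccontr)
  assume neg: "\<not> ?thesis"
  \<comment> \<open>The negated claim for \<open>\<delta> = 1 / (n + 1)\<close> yields sequences of
    pairs and ratios converging to the given ones.\<close>
  have "\<exists>x y t. x \<in> mspace X \<and> y \<in> mspace X \<and> 0 \<le> t \<and> t \<le> 1 \<and> mdist X x x0 < inverse (real (Suc n)) \<and>
      mdist X y y0 < inverse (real (Suc n)) \<and> \<bar>t - t0\<bar> < inverse (real (Suc n)) \<and>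
      \<epsilon> \<le> mdist X (geo x y t) (geo x0 y0 t0)" for n
  proof -
    have "0 < inverse (real (Suc n))" by simp
    with neg show ?thesis by (meson atLeastAtMost_iff not_less)
  qed
  then obtain x y t where xyt: "\<And>n. x n \<in> mspace X" "\<And>n. y n \<in> mspace X" "\<And>n. 0 \<le> t n" "\<And>n. t n \<le> 1"
    and xn: "\<And>n. mdist X (x n) x0 < inverse (real (Suc n))"
    and yn: "\<And>n. mdist X (y n) y0 < inverse (real (Suc n))"
    and tn: "\<And>n. \<bar>t n - t0\<bar> < inverse (real (Suc n))"
    and far: "\<And>n. \<epsilon> \<le> mdist X (geo (x n) (y n) (t n)) (geo x0 y0 t0)"
    by metis
  define \<sigma> where "\<sigma> n = geo (x n) (y n) (t n)" for n
  have "range \<sigma> \<subseteq> mspace X" using xyt geo_in by (auto simp: \<sigma>_def)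
  then obtain l r where l: "l \<in> mspace X" and r: "strict_mono r"
    and lim: "limitin (mtopology_of X) (\<sigma> \<circ> r) l sequentially"
    using compact unfolding mtopology_of_def Metric_space.compact_space_sequentially[OF Metric_space_mspace_mdist]
    by blast
  have null: "z \<longlonglongrightarrow> 0" if "\<And>n. 0 \<le> z n" "\<And>n. z n < inverse (real (Suc n))" for z
    using that less_imp_le
    by (intro tendsto_sandwich[OF _ _ tendsto_const LIMSEQ_inverse_real_of_nat] always_eventually) auto
  have "limitin (mtopology_of X) x x0 sequentially"
    unfolding limitin_mtopology_of
    using M xyt null[OF mdist_nonneg xn] by simp
  then have x: "limitin (mtopology_of X) (x \<circ> r) x0 sequentially" using r by (rule limitin_subsequence[rotated])
  have "limitin (mtopology_of X) y y0 sequentially"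
    unfolding limitin_mtopology_of
    using M xyt null[OF mdist_nonneg yn] by simp
  then have y: "limitin (mtopology_of X) (y \<circ> r) y0 sequentially" using r by (rule limitin_subsequence[rotated])
  have "(\<lambda>n. \<bar>t n - t0\<bar>) \<longlonglongrightarrow> 0" using null[OF abs_ge_zero tn] .
  then have "t \<longlonglongrightarrow> t0" by (simp add: LIM_zero_iff tendsto_rabs_zero_iff)
  then have t: "(t \<circ> r) \<longlonglongrightarrow> t0" using r by (rule LIMSEQ_subseq_LIMSEQ)
  have "mdist X x0 l = t0 * mdist X x0 y0"
  proof (rule LIMSEQ_unique)
    show "(\<lambda>n. mdist X ((x \<circ> r) n) ((\<sigma> \<circ> r) n)) \<longlonglongrightarrow> mdist X x0 l" by (intro tendsto_mdist x lim)
    have "(\<lambda>n. (t \<circ> r) n * mdist X ((x \<circ> r) n) ((y \<circ> r) n)) \<longlonglongrightarrow> t0 * mdist X x0 y0"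
      by (intro tendsto_mult tendsto_mdist x y t)
    then show "(\<lambda>n. mdist X ((x \<circ> r) n) ((\<sigma> \<circ> r) n)) \<longlonglongrightarrow> t0 * mdist X x0 y0"
      using xyt by (simp add: \<sigma>_def mdist_geo_left)
  qed
  moreover have "mdist X l y0 = (1 - t0) * mdist X x0 y0"
  proof (rule LIMSEQ_unique)
    show "(\<lambda>n. mdist X ((\<sigma> \<circ> r) n) ((y \<circ> r) n)) \<longlonglongrightarrow> mdist X l y0" by (intro tendsto_mdist y lim)
    have "(\<lambda>n. (1 - (t \<circ> r) n) * mdist X ((x \<circ> r) n) ((y \<circ> r) n)) \<longlonglongrightarrow> (1 - t0) * mdist X x0 y0"
      by (intro tendsto_intros tendsto_mdist x y t)
    then show "(\<lambda>n. mdist X ((\<sigma> \<circ> r) n) ((y \<circ> r) n)) \<longlonglongrightarrow> (1 - t0) * mdist X x0 y0"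
      using xyt by (simp add: \<sigma>_def mdist_geo_right)
  qed
  ultimately have "l = geo x0 y0 t0"
    using between_unique[OF M d, of t0 l] geo_between[OF M t0] l by (simp add: point_between_def)
  with lim have "(\<lambda>n. mdist X ((\<sigma> \<circ> r) n) (geo x0 y0 t0)) \<longlonglongrightarrow> 0"
    by (simp add: limitin_mtopology_of)
  from order_tendstoD(2)[OF this \<epsilon>] obtain n where "mdist X ((\<sigma> \<circ> r) n) (geo x0 y0 t0) < \<epsilon>"
    by (auto dest: eventually_happens)
  then show False using far[of "r n"] by (simp add: \<sigma>_def)
qed

text \<open>Joint continuity of \<open>geo\<close> in filter form, ready for the punctured
  neighbourhoods \<open>atin\<close> of an arbitrary topological space.\<close>

lemma limitin_geo:
  assumes f: "limitin (mtopology_of X) f x0 F" and g: "limitin (mtopology_of X) g y0 F"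
    and t: "(t \<longlongrightarrow> t0) F" and d: "mdist X x0 y0 < \<rho>"
    and t01: "\<forall>\<^sub>F u in F. t u \<in> {0..1}" and t0: "0 \<le> t0" "t0 \<le> 1"
  shows "limitin (mtopology_of X) (\<lambda>u. geo (f u) (g u) (t u)) (geo x0 y0 t0) F"
  unfolding limitin_mtopology_of_metric
proof (intro conjI allI impI)
  have M: "x0 \<in> mspace X" "y0 \<in> mspace X" using f g by (auto simp: limitin_mtopology_of)
  then show "geo x0 y0 t0 \<in> mspace X" using t0 by (rule geo_in)
  fix \<epsilon> :: real assume "0 < \<epsilon>"
  from geo_continuous_at[OF M d t0 this] obtain \<delta> where "\<delta> > 0"
    and \<delta>: "\<And>x y t. \<lbrakk>x \<in> mspace X; y \<in> mspace X; t \<in> {0..1}; mdist X x x0 < \<delta>; mdist X y y0 < \<delta>; \<bar>t - t0\<bar> < \<delta>\<rbrakk>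
      \<Longrightarrow> mdist X (geo x y t) (geo x0 y0 t0) < \<epsilon>" by metis
  have "\<forall>\<^sub>F u in F. f u \<in> mspace X \<and> mdist X (f u) x0 < \<delta>" "\<forall>\<^sub>F u in F. g u \<in> mspace X \<and> mdist X (g u) y0 < \<delta>"
    using f g \<open>\<delta> > 0\<close> by (auto simp: limitin_mtopology_of_metric)
  moreover have "\<forall>\<^sub>F u in F. \<bar>t u - t0\<bar> < \<delta>"
    using t \<open>\<delta> > 0\<close> by (auto simp: tendsto_iff dist_real_def)
  ultimately show "\<forall>\<^sub>F u in F. geo (f u) (g u) (t u) \<in> mspace X \<and> mdist X (geo (f u) (g u) (t u)) (geo x0 y0 t0) < \<epsilon>"
    using t01 by eventually_elim (auto intro!: geo_in \<delta>)
qed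

text \<open>Each \<open>f x\<close> slides to \<open>g x\<close> along the unique shortest path;
  \<open>limitin_geo\<close> makes this jointly continuous in the parameter and the point.\<close>

lemma nearby_maps_homotopic:
  assumes f: "continuous_map T (mtopology_of X) f" and g: "continuous_map T (mtopology_of X) g"
    and d: "\<And>x. x \<in> topspace T \<Longrightarrow> mdist X (f x) (g x) < \<rho>"
  shows "homotopic_with (\<lambda>_. True) T (mtopology_of X) f g"
proof -
  let ?P = "prod_topology (top_of_set {0..1::real}) T"
  define h where "h = (\<lambda>p. geo (f (snd p)) (g (snd p)) (fst p))"
  have "continuous_map ?P (mtopology_of X) h"
    unfolding continuous_map_atin
  proof
    fix p assume p: "p \<in> topspace ?P"
    have c: "continuous_map ?P (mtopology_of X) (f \<circ> snd)" "continuous_map ?P (mtopology_of X) (g \<circ> snd)"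
      "continuous_map ?P euclidean fst"
      using f g by (auto intro: continuous_map_compose continuous_map_snd continuous_map_into_fulltopology[OF continuous_map_fst])
    have "\<forall>\<^sub>F q in atin ?P p. q \<in> topspace ?P"
      unfolding eventually_atin using p by (blast intro: openin_topspace)
    then have "\<forall>\<^sub>F q in atin ?P p. fst q \<in> {0..1}"
      by (rule eventually_mono) auto
    then show "limitin (mtopology_of X) h (h p) (atin ?P p)"
      unfolding h_def
    proof (rule limitin_geo[rotated 4])
      show "mdist X (f (snd p)) (g (snd p)) < \<rho>" "0 \<le> fst p" "fst p \<le> 1" using p d by auto
      show "limitin (mtopology_of X) (\<lambda>q. f (snd q)) (f (snd p)) (atin ?P p)"
        "limitin (mtopology_of X) (\<lambda>q. g (snd q)) (g (snd p)) (atin ?P p)"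
        using limitin_continuous_map[OF c(1) p refl] limitin_continuous_map[OF c(2) p refl]
        by (simp_all add: o_def)
      show "(fst \<longlongrightarrow> fst p) (atin ?P p)"
        using limitin_continuous_map[OF c(3) p refl] by simp
    qed
  qed
  moreover have fg: "f x \<in> mspace X" "g x \<in> mspace X" if "x \<in> topspace T" for x
    using f g that by (auto simp: continuous_map_def)
  have "\<forall>x\<in>topspace T. h (0, x) = f x" "\<forall>x\<in>topspace T. h (1, x) = g x"
    using fg by (simp_all add: h_def geo_0 geo_1)
  ultimately show ?thesis
    by (subst homotopic_with) blast+
qed

text \<open>The map interpolates the points \<open>y i\<close> with weights \<open>w i\<close>, adding them one at a time along
  geodesics. It is unspecified, and possibly discontinuous, where all weights so far vanish.\<close>

lemma partial_interpolation_exists: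
  fixes w :: "nat \<Rightarrow> 'b \<Rightarrow> real"
  assumes w: "\<And>i. i < n \<Longrightarrow> continuous_map T euclideanreal (w i)"
    and w0: "\<And>i x. 0 \<le> w i x"
    and y: "\<And>i. i < n \<Longrightarrow> y i \<in> mspace X"
    and close: "\<And>x i j. \<lbrakk>x \<in> topspace T; i < n; j < n; 0 < w i x; 0 < w j x\<rbrakk> \<Longrightarrow> mdist X (y i) (y j) < s"
    and s: "s < \<rho>" and ne: "mspace X \<noteq> {}" and "k \<le> n"
  shows "\<exists>h. (\<forall>x. h x \<in> mspace X) \<and>
    (\<forall>x\<in>topspace T. 0 < (\<Sum>i<k. w i x) \<longrightarrow>
       limitin (mtopology_of X) h (h x) (atin T x) \<and>
       (\<forall>j<n. 0 < w j x \<longrightarrow> mdist X (y j) (h x) < s))"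
  using \<open>k \<le> n\<close>
proof (induction k)
  case 0
  obtain a where "a \<in> mspace X" using ne by blast
  then show ?case by (intro exI[of _ "\<lambda>_. a"]) auto
next
  case (Suc k)
  then obtain h where hM: "\<And>x. h x \<in> mspace X"
    and hlim: "\<And>x. \<lbrakk>x \<in> topspace T; 0 < (\<Sum>i<k. w i x)\<rbrakk> \<Longrightarrow> limitin (mtopology_of X) h (h x) (atin T x)"
    and hd: "\<And>x j. \<lbrakk>x \<in> topspace T; 0 < (\<Sum>i<k. w i x); j < n; 0 < w j x\<rbrakk> \<Longrightarrow> mdist X (y j) (h x) < s"
    by (auto dest: Suc_leD)
  have k: "k < n" and yk: "y k \<in> mspace X" using Suc y by auto
  define S where "S x = (\<Sum>i<k. w i x)" for x
  \<comment> \<open>The share of the new weight in the total. Where both weights vanish, division by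
    zero gives 0, so the ratio is in the unit interval everywhere.\<close>
  define t where "t x = w k x / (S x + w k x)" for x
  define h' where "h' x = geo (h x) (y k) (t x)" for x
  have S0: "0 \<le> S x" for x using w0 by (auto simp: S_def intro: sum_nonneg)
  have t01: "0 \<le> t x" "t x \<le> 1" for x
    using S0[of x] w0[of k x] by (auto simp: t_def divide_le_eq_1)
  have h'M: "h' x \<in> mspace X" for x unfolding h'_def using hM yk t01 by (rule geo_in)
  \<comment> \<open>A bound on all distances, by compactness. It replaces continuity of
    \<open>geo\<close> at points where one of the two weights vanishes and \<open>h x\<close> and
    \<open>y k\<close> may be far apart.\<close>
  obtain D where D: "\<And>x y. \<lbrakk>x \<in> mspace X; y \<in> mspace X\<rbrakk> \<Longrightarrow> mdist X x y \<le> D"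
  proof -
    have "Metric_space.mbounded (mspace X) (mdist X) (mspace X)"
      using compact Metric_space.compactin_imp_mbounded[OF Metric_space_mspace_mdist[of X]]
      by (simp add: compact_space_def mtopology_of_def Metric_space.topspace_mtopology)
    then show thesis
      using that by (auto simp: Metric_space.mbounded_alt[OF Metric_space_mspace_mdist])
  qed
  have "limitin (mtopology_of X) h' (h' x) (atin T x) \<and> (\<forall>j<n. 0 < w j x \<longrightarrow> mdist X (y j) (h' x) < s)"
    if x: "x \<in> topspace T" and pos: "0 < S x + w k x" for x
  proof
    have "continuous_map T euclideanreal S"
      unfolding S_def using k by (intro continuous_map_sum w) auto
    then have tlim: "(t \<longlongrightarrow> t x) (atin T x)"
      using w[OF k] x pos unfolding t_def continuous_map_atin
      by (auto intro!: tendsto_intros)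
    consider "0 < S x" "0 < w k x" | "0 < S x" "w k x = 0" | "S x = 0" "0 < w k x"
      using S0[of x] w0[of k x] pos by linarith
    then have "limitin (mtopology_of X) h' (h' x) (atin T x) \<and> (\<forall>j<n. 0 < w j x \<longrightarrow> mdist X (y j) (h' x) < s)"
    proof cases
      \<comment> \<open>Both ends are closer than \<rho>, so \<open>geo\<close> is continuous there.
        The ball of radius \<open>s\<close> around any active \<open>y j\<close> contains both ends,
        hence also the new point.\<close>
      case 1
      have "mdist X (y k) (h x) < s" using hd x 1 k by (simp add: S_def)
      then have "mdist X (h x) (y k) < \<rho>" using s mdist_commute[of X "h x" "y k"] by linarith
      moreover have "limitin (mtopology_of X) h (h x) (atin T x)" using hlim x 1 by (simp add: S_def)
      ultimately have "limitin (mtopology_of X) h' (h' x) (atin T x)"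
        unfolding h'_def using tlim t01 yk by (intro limitin_geo) simp_all
      moreover have "mdist X (y j) (h' x) < s" if j: "j < n" "0 < w j x" for j
      proof (rule ball_convex[OF hM yk y[OF j(1)] _ _ _ s])
        show "point_between X (t x) (h x) (y k) (h' x)"
          unfolding h'_def by (rule geo_between[OF hM yk t01])
        show "mdist X (y j) (h x) < s" using hd x 1 j by (simp add: S_def)
        show "mdist X (y j) (y k) < s" using close x j k 1 by blast
      qed
      ultimately show ?thesis by blast
    next
      \<comment> \<open>The new weight vanishes at \<open>x\<close>: nearby, \<open>h'\<close>
        differs from \<open>h\<close> by at most \<open>t u * D\<close>, which tends to 0, and
        \<open>h\<close> is continuous at \<open>x\<close> by induction.\<close>
      case 2
      then have t: "t x = 0" and h': "h' x = h x" by (auto simp: t_def h'_def geo_0 hM yk)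
      have "((\<lambda>u. mdist X (h' u) (h x)) \<longlongrightarrow> 0) (atin T x)"
      proof (rule tendsto_sandwich[OF _ _ tendsto_const])
        show "\<forall>\<^sub>F u in atin T x. mdist X (h' u) (h x) \<le> t u * D + mdist X (h u) (h x)"
        proof (rule always_eventually, rule allI)
          fix u
          have "mdist X (h' u) (h x) \<le> mdist X (h' u) (h u) + mdist X (h u) (h x)"
            using h'M hM by (intro mdist_triangle)
          moreover have "mdist X (h' u) (h u) = t u * mdist X (h u) (y k)"
            using mdist_geo_left[OF hM yk t01] by (simp add: h'_def mdist_commute)
          moreover have "\<dots> \<le> t u * D" using D hM yk t01 by (intro mult_left_mono) auto
          ultimately show "mdist X (h' u) (h x) \<le> t u * D + mdist X (h u) (h x)" by linarith
        qed
        have "((\<lambda>u. mdist X (h u) (h x)) \<longlongrightarrow> 0) (atin T x)"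
          using hlim[OF x] 2 by (simp add: S_def limitin_mtopology_of)
        with tlim have "((\<lambda>u. t u * D + mdist X (h u) (h x)) \<longlongrightarrow> 0 * D + 0) (atin T x)"
          unfolding t by (intro tendsto_intros)
        then show "((\<lambda>u. t u * D + mdist X (h u) (h x)) \<longlongrightarrow> 0) (atin T x)" by simp
      qed simp
      then show ?thesis using h' hM h'M hd[OF x] 2 by (simp add: limitin_mtopology_of S_def)
    next
      \<comment> \<open>All earlier weights vanish at \<open>x\<close> and nothing is known about
        the limit of \<open>h\<close> there. As the ratio tends to 1, \<open>h'\<close> tends to
        \<open>y k\<close> whatever \<open>h\<close> does.\<close>
      case 3
      then have t: "t x = 1" and h': "h' x = y k" by (auto simp: t_def h'_def geo_1 hM yk)
      have "((\<lambda>u. mdist X (h' u) (y k)) \<longlongrightarrow> 0) (atin T x)"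
      proof (rule tendsto_sandwich[OF _ _ tendsto_const])
        have "mdist X (h' u) (y k) \<le> (1 - t u) * D" for u
          unfolding h'_def mdist_geo_right[OF hM yk t01]
          using D hM yk t01 by (intro mult_left_mono) auto
        then show "\<forall>\<^sub>F u in atin T x. mdist X (h' u) (y k) \<le> (1 - t u) * D" by simp
        from tlim have "((\<lambda>u. (1 - t u) * D) \<longlongrightarrow> (1 - 1) * D) (atin T x)"
          unfolding t by (intro tendsto_intros)
        then show "((\<lambda>u. (1 - t u) * D) \<longlongrightarrow> 0) (atin T x)" by simp
      qed simp
      then show ?thesis using h' yk h'M close[OF x _ k] 3 by (simp add: limitin_mtopology_of)
    qed
    then show "limitin (mtopology_of X) h' (h' x) (atin T x)"
      and "\<forall>j<n. 0 < w j x \<longrightarrow> mdist X (y j) (h' x) < s" by auto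
  qed
  then show ?case using h'M by (intro exI[of _ h']) (simp add: S_def)
qed

end

section \<open>Continuous maps approximating a correspondence\<close>

lemma approximating_map_exists:
  assumes X: "compact_space (mtopology_of X)" and Y: "locally_convex_geodesic Y \<rho>"
    and \<epsilon>: "0 < \<epsilon>" "4 * \<epsilon> < \<rho>"
    and R: "\<And>x y. R x y \<Longrightarrow> x \<in> mspace X \<and> y \<in> mspace Y"
    and total: "\<And>x. x \<in> mspace X \<Longrightarrow> \<exists>y. R x y"
    and distort: "\<And>x y x' y'. \<lbrakk>R x y; R x' y'\<rbrakk> \<Longrightarrow> mdist Y y y' < mdist X x x' + 2 * \<epsilon>"
  obtains f where "continuous_map (mtopology_of X) (mtopology_of Y) f"
    "\<And>x. x \<in> mspace X \<Longrightarrow> \<exists>x' y'. R x' y' \<and> mdist X x x' < \<epsilon> \<and> mdist Y (f x) y' < 4 * \<epsilon>"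
proof (cases "mspace X = {}")
  \<comment> \<open>The empty space is set apart because interpolation needs a point in the target;
    any function is continuous on it.\<close>
  case True
  then show ?thesis
    using that[of undefined] by (simp add: continuous_map_def)
next
  case False
  interpret Y: locally_convex_geodesic Y \<rho> by (fact Y)
  obtain K where K: "finite K" "K \<subseteq> mspace X" "mspace X \<subseteq> (\<Union>x\<in>K. mball_of X x \<epsilon>)"
    using X \<epsilon>(1) unfolding mtopology_of_def mball_of_def
      Metric_space.compact_space_eq_mcomplete_mtotally_bounded[OF Metric_space_mspace_mdist]
      Metric_space.mtotally_bounded_def[OF Metric_space_mspace_mdist] by blast
  obtain p and n :: nat where p: "K = p ` {i. i < n}"
    using finite_imp_nat_seg_image_inj_on[OF K(1)] by blast
  have pX: "p i \<in> mspace X" if "i < n" for i using that K p by auto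
  define y where "y i = (SOME y. R (p i) y)" for i
  have y: "R (p i) (y i)" if "i < n" for i
    unfolding y_def using total[OF pX[OF that]] by (rule someI_ex)
  \<comment> \<open>A bump function that is positive exactly on the \<epsilon>-ball around the net
    point \<open>p i\<close>.\<close>
  define w where "w i x = max 0 (\<epsilon> - mdist X (p i) x)" for i x
  have pos: "0 < w i x \<longleftrightarrow> mdist X (p i) x < \<epsilon>" for i x by (auto simp: w_def)
  obtain h where hM: "\<And>x. h x \<in> mspace Y" and
    h: "\<And>x. \<lbrakk>x \<in> mspace X; 0 < (\<Sum>i<n. w i x)\<rbrakk> \<Longrightarrow> limitin (mtopology_of Y) h (h x) (atin (mtopology_of X) x) \<and>
       (\<forall>j<n. 0 < w j x \<longrightarrow> mdist Y (y j) (h x) < 4 * \<epsilon>)"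
  proof -
    have "\<exists>h. (\<forall>x. h x \<in> mspace Y) \<and>
      (\<forall>x\<in>topspace (mtopology_of X). 0 < (\<Sum>i<n. w i x) \<longrightarrow>
       limitin (mtopology_of Y) h (h x) (atin (mtopology_of X) x) \<and>
       (\<forall>j<n. 0 < w j x \<longrightarrow> mdist Y (y j) (h x) < 4 * \<epsilon>))"
    proof (rule Y.partial_interpolation_exists[OF _ _ _ _ \<epsilon>(2) _ order_refl])
      show "continuous_map (mtopology_of X) euclideanreal (w i)" if "i < n" for i
        unfolding w_def using pX[OF that] by (intro continuous_intros continuous_map_mdist) auto
      show "0 \<le> w i x" for i x by (simp add: w_def)
      show "y i \<in> mspace Y" if "i < n" for i using y[OF that] R by blast
      show "mspace Y \<noteq> {}" using False total R by blast
      fix x i j assume "x \<in> topspace (mtopology_of X)" and ij: "i < n" "j < n" and "0 < w i x" "0 < w j x"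
      then have "x \<in> mspace X" "mdist X (p i) x < \<epsilon>" "mdist X x (p j) < \<epsilon>"
        by (auto simp: pos mdist_commute)
      then have "mdist X (p i) (p j) < 2 * \<epsilon>"
        using mdist_triangle[OF pX[OF ij(1)] _ pX[OF ij(2)], of x] by linarith
      \<comment> \<open>Net points active at a common \<open>x\<close> are closer than
        \<open>2 * \<epsilon>\<close>, and the distortion adds another
        \<open>2 * \<epsilon>\<close>.\<close>
      then show "mdist Y (y i) (y j) < 4 * \<epsilon>"
        using distort[OF y[OF ij(1)] y[OF ij(2)]] by linarith
    qed
    then show thesis using that by auto
  qed
  have ex: "\<exists>i<n. 0 < w i x" if x: "x \<in> mspace X" for x
  proof -
    obtain i where "i < n" "x \<in> mball_of X (p i) \<epsilon>" using K(3) x unfolding p by blast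
    then show ?thesis unfolding pos by auto
  qed
  have sum: "0 < (\<Sum>i<n. w i x)" if x: "x \<in> mspace X" for x
  proof -
    obtain i where "i < n" "0 < w i x" using ex[OF x] by blast
    then show ?thesis by (intro sum_pos2[of _ i]) (auto simp: w_def)
  qed
  show ?thesis
  proof (rule that)
    show "continuous_map (mtopology_of X) (mtopology_of Y) h"
      using h sum by (simp add: continuous_map_atin)
    fix x assume x: "x \<in> mspace X"
    obtain i where i: "i < n" "0 < w i x" using ex[OF x] by blast
    then have "mdist Y (h x) (y i) < 4 * \<epsilon>" using h[OF x sum[OF x]] by (simp add: mdist_commute)
    moreover have "mdist X x (p i) < \<epsilon>" using i pos by (simp add: mdist_commute)
    ultimately show "\<exists>x' y'. R x' y' \<and> mdist X x x' < \<epsilon> \<and> mdist Y (h x) y' < 4 * \<epsilon>"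
      using y[OF i(1)] by blast
  qed
qed

text \<open>Let \<open>(x1, y1)\<close> be a related pair near \<open>(x, f x)\<close> and
  \<open>(x2, y2)\<close> one near \<open>(g (f x), f x)\<close>. Then \<open>y1\<close> and
  \<open>y2\<close> are closer than \<open>5 * \<epsilon>\<close>, hence \<open>x1\<close> and
  \<open>x2\<close> closer than \<open>7 * \<epsilon>\<close>; the ends add
  \<open>\<epsilon>\<close> and \<open>4 * \<epsilon>\<close>.\<close>

lemma approximate_inverse:
  assumes f: "\<And>x. x \<in> mspace X \<Longrightarrow> f x \<in> mspace Y" and g: "\<And>y. y \<in> mspace Y \<Longrightarrow> g y \<in> mspace X"
    and R: "\<And>x y. R x y \<Longrightarrow> x \<in> mspace X \<and> y \<in> mspace Y"
    and distort: "\<And>x y x' y'. \<lbrakk>R x y; R x' y'\<rbrakk> \<Longrightarrow> mdist X x x' < mdist Y y y' + 2 * \<epsilon>"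
    and fR: "\<And>x. x \<in> mspace X \<Longrightarrow> \<exists>x' y'. R x' y' \<and> mdist X x x' < \<epsilon> \<and> mdist Y (f x) y' < 4 * \<epsilon>"
    and gR: "\<And>y. y \<in> mspace Y \<Longrightarrow> \<exists>x' y'. R x' y' \<and> mdist Y y y' < \<epsilon> \<and> mdist X (g y) x' < 4 * \<epsilon>"
    and x: "x \<in> mspace X"
  shows "mdist X (g (f x)) x < 12 * \<epsilon>"
proof -
  obtain x1 y1 where 1: "R x1 y1" "mdist X x x1 < \<epsilon>" "mdist Y (f x) y1 < 4 * \<epsilon>" using fR[OF x] by blast
  obtain x2 y2 where 2: "R x2 y2" "mdist Y (f x) y2 < \<epsilon>" "mdist X (g (f x)) x2 < 4 * \<epsilon>"
    using gR[OF f[OF x]] by blast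
  have "mdist Y y2 y1 \<le> mdist Y y2 (f x) + mdist Y (f x) y1"
    "mdist X (g (f x)) x \<le> mdist X (g (f x)) x2 + mdist X x2 x"
    "mdist X x2 x \<le> mdist X x2 x1 + mdist X x1 x"
    using 1(1) 2(1) R x f g by (auto intro!: mdist_triangle)
  moreover have "mdist X x2 x1 < mdist Y y2 y1 + 2 * \<epsilon>" using 1(1) 2(1) distort by blast
  ultimately show ?thesis 
    using 1 2 mdist_commute[of Y y2 "f x"] mdist_commute[of X x1 x] by linarith
qed

text \<open>Points are related when their images in a common space \<open>Z\<close> are closer than
  some \<open>r < \<epsilon>\<close>. Exchanging both ends of a segment for related points changes
  its length by less than \<open>2 * r\<close>.\<close>

lemma GH_dist_correspondence:
  assumes "GH_dist X Y < ereal \<epsilon>"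
  obtains R where "\<And>x y. R x y \<Longrightarrow> x \<in> mspace X \<and> y \<in> mspace Y"
    "\<And>x. x \<in> mspace X \<Longrightarrow> \<exists>y. R x y" "\<And>y. y \<in> mspace Y \<Longrightarrow> \<exists>x. R x y"
    "\<And>x y x' y'. \<lbrakk>R x y; R x' y'\<rbrakk> \<Longrightarrow> \<bar>mdist X x x' - mdist Y y y'\<bar> < 2 * \<epsilon>"
proof -
  obtain Z :: "('a + 'b) metric" and f g where f: "isometric_embedding X Z f" and g: "isometric_embedding Y Z g"
    and "hausdorff_dist Z (f ` mspace X) (g ` mspace Y) < ereal \<epsilon>"
    using assms unfolding GH_dist_def Inf_less_iff by blast
  then obtain r where r: "r < \<epsilon>" and XY: "f ` mspace X \<subseteq> (\<Union>b\<in>g ` mspace Y. mball_of Z b r)"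
    and YX: "g ` mspace Y \<subseteq> (\<Union>a\<in>f ` mspace X. mball_of Z a r)"
    unfolding hausdorff_dist_def Inf_less_iff by auto
  define R where "R x y \<longleftrightarrow> x \<in> mspace X \<and> y \<in> mspace Y \<and> mdist Z (f x) (g y) < r" for x y
  show thesis
  proof (rule that[of R])
    show "\<And>x y. R x y \<Longrightarrow> x \<in> mspace X \<and> y \<in> mspace Y" by (simp add: R_def)
    show "\<exists>y. R x y" if "x \<in> mspace X" for x
    proof -
      have "f x \<in> (\<Union>b\<in>g ` mspace Y. mball_of Z b r)" using XY that by blast
      then show ?thesis using that by (auto simp: R_def mdist_commute)
    qed
    show "\<exists>x. R x y" if "y \<in> mspace Y" for y
    proof -
      have "g y \<in> (\<Union>a\<in>f ` mspace X. mball_of Z a r)" using YX that by blast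
      then show ?thesis using that by (auto simp: R_def)
    qed
    fix x y x' y' assume R: "R x y" "R x' y'"
    then have M: "f x \<in> mspace Z" "f x' \<in> mspace Z" "g y \<in> mspace Z" "g y' \<in> mspace Z"
      and eq: "mdist Z (f x) (f x') = mdist X x x'" "mdist Z (g y) (g y') = mdist Y y y'"
      using f g by (auto simp: R_def isometric_embedding_def)
    have "mdist Z (f x) (f x') \<le> mdist Z (f x) (g y) + mdist Z (g y) (f x')"
      "mdist Z (g y) (f x') \<le> mdist Z (g y) (g y') + mdist Z (g y') (f x')"
      "mdist Z (g y) (g y') \<le> mdist Z (g y) (f x) + mdist Z (f x) (g y')"
      "mdist Z (f x) (g y') \<le> mdist Z (f x) (f x') + mdist Z (f x') (g y')"
      using M by (auto intro: mdist_triangle)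
    then show "\<bar>mdist X x x' - mdist Y y y'\<bar> < 2 * \<epsilon>"
      using R r eq mdist_commute[of Z "f x" "g y"] mdist_commute[of Z "f x'" "g y'"]
      unfolding R_def by linarith
  qed
qed

lemma GH_close_imp_homotopy_equivalent:
  assumes X: "locally_convex_geodesic X \<rho>" and Y: "locally_convex_geodesic Y \<rho>"
    and \<rho>: "0 < \<rho>" and GH: "GH_dist X Y < ereal (\<rho> / 12)"
  shows "mtopology_of X homotopy_equivalent_space mtopology_of Y"
proof -
  interpret X: locally_convex_geodesic X \<rho> by (fact X)
  interpret Y: locally_convex_geodesic Y \<rho> by (fact Y)
  \<comment> \<open>Chosen so that the bound \<open>12 * \<epsilon>\<close> of
    \<open>approximate_inverse\<close> is \<rho>, the range in which nearby maps are
    homotopic.\<close>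
  define \<epsilon> where "\<epsilon> = \<rho> / 12"
  have \<epsilon>: "0 < \<epsilon>" "4 * \<epsilon> < \<rho>" and \<rho>_eq: "\<rho> = 12 * \<epsilon>" using \<rho> by (auto simp: \<epsilon>_def)
  from GH obtain R where R: "\<And>x y. R x y \<Longrightarrow> x \<in> mspace X \<and> y \<in> mspace Y"
    and tot: "\<And>x. x \<in> mspace X \<Longrightarrow> \<exists>y. R x y" "\<And>y. y \<in> mspace Y \<Longrightarrow> \<exists>x. R x y"
    and dis: "\<And>x y x' y'. \<lbrakk>R x y; R x' y'\<rbrakk> \<Longrightarrow> \<bar>mdist X x x' - mdist Y y y'\<bar> < 2 * \<epsilon>"
    unfolding \<epsilon>_def[symmetric] by (rule GH_dist_correspondence) blast
  have dis1: "mdist Y y y' < mdist X x x' + 2 * \<epsilon>" and dis2: "mdist X x x' < mdist Y y y' + 2 * \<epsilon>"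
    if "R x y" "R x' y'" for x y x' y'
    using dis[OF that] by auto
  obtain f where f: "continuous_map (mtopology_of X) (mtopology_of Y) f"
    and fR: "\<And>x. x \<in> mspace X \<Longrightarrow> \<exists>x' y'. R x' y' \<and> mdist X x x' < \<epsilon> \<and> mdist Y (f x) y' < 4 * \<epsilon>"
    using approximating_map_exists[where R = R, OF X.compact Y \<epsilon> R tot(1) dis1] by blast
  obtain g where g: "continuous_map (mtopology_of Y) (mtopology_of X) g"
    and gR: "\<And>y. y \<in> mspace Y \<Longrightarrow> \<exists>y' x'. R x' y' \<and> mdist Y y y' < \<epsilon> \<and> mdist X (g y) x' < 4 * \<epsilon>"
  \<comment> \<open>The map back comes from the same correspondence read in the opposite
    direction.\<close>
  proof (rule approximating_map_exists[where R = "\<lambda>y x. R x y", OF Y.compact X \<epsilon>])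
    show "\<And>x y. R y x \<Longrightarrow> x \<in> mspace Y \<and> y \<in> mspace X" using R by blast
    show "\<And>x. x \<in> mspace Y \<Longrightarrow> \<exists>y. R y x" by (rule tot)
    show "\<And>x y x' y'. \<lbrakk>R y x; R y' x'\<rbrakk> \<Longrightarrow> mdist X y y' < mdist Y x x' + 2 * \<epsilon>" by (rule dis2)
  qed blast
  have fM: "f x \<in> mspace Y" if "x \<in> mspace X" for x using f that by (auto simp: continuous_map_def)
  have gM: "g y \<in> mspace X" if "y \<in> mspace Y" for y using g that by (auto simp: continuous_map_def)
  have gf: "mdist X (g (f x)) x < \<rho>" if x: "x \<in> mspace X" for x
    unfolding \<rho>_eq
    by (rule approximate_inverse[where R = R and f = f and g = g, OF fM gM R dis2 fR _ x]) (use gR in blast)+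
  have fg: "mdist Y (f (g y)) y < \<rho>" if y: "y \<in> mspace Y" for y
    unfolding \<rho>_eq
    by (rule approximate_inverse[where R = "\<lambda>y x. R x y" and f = g and g = f, OF gM fM _ dis1 gR _ y])
      (use R fR in blast)+
  have "homotopic_with (\<lambda>_. True) (mtopology_of X) (mtopology_of X) (g \<circ> f) id"
    using f g gf by (intro X.nearby_maps_homotopic continuous_map_compose) auto
  moreover have "homotopic_with (\<lambda>_. True) (mtopology_of Y) (mtopology_of Y) (f \<circ> g) id"
    using f g fg by (intro Y.nearby_maps_homotopic continuous_map_compose) auto
  ultimately show ?thesis using f g unfolding homotopy_equivalent_space_def by blast
qed

section \<open>Finiteness of the set of homotopy types\<close>

theorem corollary4:
  fixes \<kappa> \<rho>\<^sub>0 :: real and F :: "'a metric set"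
  assumes "\<rho>\<^sub>0 > 0"
    and "\<And>X. X \<in> F \<Longrightarrow> compact_space (mtopology_of X)"
    and "\<And>X. X \<in> F \<Longrightarrow> curvature_le \<kappa> X"
    and "\<And>X. X \<in> F \<Longrightarrow> convexity_radius X \<ge> ereal \<rho>\<^sub>0"
    and "GH_precompact F"
  shows "finite (homotopy_types F)"
proof -
  have geodesic: "locally_convex_geodesic X \<rho>\<^sub>0" if "X \<in> F" for X
    using assms(2-4)[OF that] by (intro locally_convex_geodesicI) (auto simp: curvature_le_def)
  have "0 < \<rho>\<^sub>0 / 12" using assms(1) by simp
  with assms(5) have "\<exists>K. finite K \<and> K \<subseteq> F \<and> (\<forall>X\<in>F. \<exists>Y\<in>K. GH_dist Y X < ereal (\<rho>\<^sub>0 / 12))"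
    unfolding GH_precompact_def by (elim conjE allE[of _ "\<rho>\<^sub>0 / 12"]) simp
  then obtain K where K: "finite K" "K \<subseteq> F"
    and near: "\<And>X. X \<in> F \<Longrightarrow> \<exists>Y\<in>K. GH_dist Y X < ereal (\<rho>\<^sub>0 / 12)"
    by metis
  \<comment> \<open>Every class has a representative in the finite net \<open>K\<close>.\<close>
  have "homotopy_types F \<subseteq> (\<lambda>Y. same_homotopy_type `` {Y}) ` K"
  proof
    fix C assume "C \<in> homotopy_types F"
    then obtain X where X: "X \<in> F" and C: "C = same_homotopy_type `` {X}"
      unfolding homotopy_types_def by (rule quotientE)
    obtain Y where Y: "Y \<in> K" "GH_dist Y X < ereal (\<rho>\<^sub>0 / 12)" using near[OF X] by blast
    then have "mtopology_of Y homotopy_equivalent_space mtopology_of X"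
      using X K(2) assms(1) by (intro GH_close_imp_homotopy_equivalent[where \<rho> = "\<rho>\<^sub>0"] geodesic) auto
    \<comment> \<open>The classes of \<open>X\<close> and \<open>Y\<close> range over all metrics on
      the type, so they are compared at an arbitrary \<open>Z\<close>, by symmetry and
      transitivity.\<close>
    then have "mtopology_of X homotopy_equivalent_space mtopology_of Z \<longleftrightarrow>
        mtopology_of Y homotopy_equivalent_space mtopology_of Z" for Z :: "'a metric"
      using homotopy_eqv_trans homotopy_equivalent_space_sym by metis
    then have "same_homotopy_type `` {X} = same_homotopy_type `` {Y}"
      by (simp add: same_homotopy_type_def)
    then show "C \<in> (\<lambda>Y. same_homotopy_type `` {Y}) ` K" using Y(1) C by blast
  qed
  then show ?thesis using K(1) by (rule finite_subset[OF _ finite_imageI])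
qed

end
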